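(* Let $q$ be a prime power, $m\ge 1$ an integer, $g\in\mathbb{F}_q[x]$ a monic divisor of $x^m-1$, and $\alpha\in\mathbb{F}_{q^m}$ a normal element over $\mathbb{F}_q$. Then $$\sum_{\substack{f\in\mathbb{F}_q[x]\\ \deg f<m}}\left|\sum_{\chi}\chi(f\circ\alpha)\right|=q^{m-\deg g}\,\phi(g)\,W(g),$$ where the outer sum runs over all polynomials $f$ of degree less than $m$ (including $f=0$) and the inner sum runs over all additive characters $\chi$ of $\mathbb{F}_{q^m}$ of $\mathbb{F}_q$-Order $g$.
   Context: For $l(x)=\sum_{i=0}^n a_i x^i\in\mathbb{F}_q[x]$ and $\gamma\in\mathbb{F}_{q^m}$, write $l\circ\gamma=\sum_{i=0}^n a_i\gamma^{q^i}$. An element $\alpha\in\mathbb{F}_{q^m}$ is normal over $\mathbb{F}_q$ if $\alpha,\alpha^q,\dots,\alpha^{q^{m-1}}$ form a basis of $\mathbb{F}_{q^m}$ over $\mathbb{F}_q$. An additive character of $\mathbb{F}_{q^m}$ is a group homomorphism $\chi:(\mathbb{F}_{q^m},+)\to\mathbb{C}^*$; its $\mathbb{F}_q$-Order is the unique monic polynomial $f\in\mathbb{F}_q[x]$ of least degree such that $\chi(f\circ\gamma)=1$ for all $\gamma\in\mathbb{F}_{q^m}$. For a nonzero $f\in\mathbb{F}_q[x]$: $\phi(f)$ is the number of polynomials in $\mathbb{F}_q[x]$ of degree less than $\deg f$ that are coprime to $f$ (with $\phi(1)=1$); $W(f)$ is the number of monic square-free divisors of $f$ in $\mathbb{F}_q[x]$,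 i.e. $2^{w(f)}$ with $w(f)$ the number of distinct monic irreducible factors of $f$. *)

theory Defs
  imports
    Complex_Main
    "HOL-Library.Cardinality"
    "HOL-Computational_Algebra.Squarefree"
    "Berlekamp_Zassenhaus.Unique_Factorization"
begin

text \<open>
  The extension $\mathbb{F}_{q^m} / \mathbb{F}_q$ is modelled by two finite field types
  \<open>'k\<close> and \<open>'l\<close> and a field homomorphism \<open>emb :: 'k \<Rightarrow> 'l\<close>
  (automatically injective), with $q = \mathrm{CARD}('k)$.
\<close>

definition qaction :: "('k::{finite,field} \<Rightarrow> 'l::{finite,field}) \<Rightarrow> 'k poly \<Rightarrow> 'l \<Rightarrow> 'l" where
  "qaction emb f \<gamma> = (\<Sum>i\<le>degree f. emb (coeff f i) * \<gamma> ^ (CARD('k) ^ i))"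

definition ext_scale :: "('k::field \<Rightarrow> 'l::field) \<Rightarrow> 'k \<Rightarrow> 'l \<Rightarrow> 'l" where
  "ext_scale emb c x = emb c * x"

lemma vector_space_ext_scale:
  assumes "field_hom emb"
  shows "vector_space (ext_scale emb)"
proof -
  interpret field_hom emb by fact
  show ?thesis
    by unfold_locales (simp_all add: ext_scale_def hom_distribs algebra_simps)
qed

text \<open>
  The basis condition is on the family of conjugates, not just on its range, hence the
  injectivity requirement.
\<close>

definition normal_element :: "('k::{finite,field} \<Rightarrow> 'l::{finite,field}) \<Rightarrow> nat \<Rightarrow> 'l \<Rightarrow> bool" where
  "normal_element emb m \<alpha> \<longleftrightarrow>
     (let cj = (\<lambda>i. \<alpha> ^ (CARD('k) ^ i)); B = cj ` {..<m} in
        inj_on cj {..<m} \<and>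
        \<not> module.dependent (ext_scale emb) B \<and>
        module.span (ext_scale emb) B = UNIV)"

definition additive_character :: "('l::{finite,field} \<Rightarrow> complex) \<Rightarrow> bool" where
  "additive_character \<chi> \<longleftrightarrow>
     (\<forall>x. \<chi> x \<noteq> 0) \<and> (\<forall>x y. \<chi> (x + y) = \<chi> x * \<chi> y)"

definition qannihilates ::
    "('k::{finite,field} \<Rightarrow> 'l::{finite,field}) \<Rightarrow> 'k poly \<Rightarrow> ('l \<Rightarrow> complex) \<Rightarrow> bool" where
  "qannihilates emb f \<chi> \<longleftrightarrow> (\<forall>\<gamma>. \<chi> (qaction emb f \<gamma>) = 1)"

definition Fq_Order ::
    "('k::{finite,field} \<Rightarrow> 'l::{finite,field}) \<Rightarrow> ('l \<Rightarrow> complex) \<Rightarrow> 'k poly" where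
  "Fq_Order emb \<chi> =
     (THE f. monic f \<and> qannihilates emb f \<chi> \<and>
             (\<forall>h. monic h \<and> qannihilates emb h \<chi> \<longrightarrow> degree f \<le> degree h))"

text \<open>
  Since \<open>degree 0 = 0\<close> in the library, the disjunct \<open>h = 0\<close> restores the
  convention $\deg 0 = -\infty$; it gives the value 1 at nonzero constants and changes
  nothing for polynomials of positive degree.
\<close>

definition poly_phi :: "'k::{finite,field} poly \<Rightarrow> nat" where
  "poly_phi f = card {h. (h = 0 \<or> degree h < degree f) \<and> coprime h f}"

definition poly_W :: "'k::{finite,field} poly \<Rightarrow> nat" where
  "poly_W f = card {d. monic d \<and> squarefree d \<and> d dvd f}"

end

theory Submission
  imports Defs
begin

text \<open>
  Write $[\dots]$ for the indicator of a condition. Through $f \mapsto f \circ \alpha$ the normal element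
  identifies $\mathbb{F}_{q^m}$ with the polynomials modulo $X^m - 1$ (\<open>normal_element_bij_betw\<close>,
  \<open>qaction_eq_0_iff\<close>). Under this identification the characters annihilated by a divisor $h$ of
  $X^m - 1$ are those trivial on the multiples of $h$, so orthogonality of characters gives
  $\sum_\chi \chi(f \circ \alpha) = q^{\deg h}\,[h \mid f]$ for the sum over all of them
  (\<open>sum_annihilated_characters\<close>).

  Let $g = \prod_P P^{a_P + 1}$ and $N_P = q^{\deg P}$. Inclusion and exclusion over the primes of $g$
  turns the sum over the characters of order exactly $g$ into an Euler product
  (\<open>sum_characters_of_order\<close>):
  $$S(f) = \prod_P \bigl(N_P^{a_P+1}\,[P^{a_P+1} \mid f] - N_P^{a_P}\,[P^{a_P} \mid f]\bigr).$$
  The absolute value of each factor is once more a combination of the same two indicators, namely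
  $N_P^{a_P}\,[P^{a_P} \mid f] + (N_P^{a_P+1} - 2N_P^{a_P})\,[P^{a_P+1} \mid f]$. Divisibility by powers
  of different primes is independent for $f$ ranging over all polynomials of degree less than $m$, and
  $P^e$ divides $f$ with probability $N_P^{-e}$ (\<open>sum_prod_two_exponents\<close>). Hence
  $$\sum_f |S(f)| = q^m \prod_P \bigl(1 + 1 - 2/N_P\bigr)
    = q^{m - \deg g} \cdot q^{\deg g} \prod_P \bigl(1 - 1/N_P\bigr) \cdot \prod_P 2.$$
  The same independence principle identifies the middle factor with $\phi(g)$
  (\<open>poly_phi_prod_powers\<close>), and the last one counts the sets of primes of $g$, that is, its monic
  squarefree divisors (\<open>card_squarefree_divisors\<close>).
\<close>

section \<open>Prime factorizations and squarefree divisors\<close>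

lemma irreducible_poly_not_dvd_1: "irreducible (P::'a::field poly) \<Longrightarrow> \<not> P dvd 1"
  by (rule irreducible_not_unit)

lemma monic_irreducible_dvd_prodD:
  fixes A :: "'a::field poly set"
  assumes "finite A" "A \<subseteq> {P. irreducible P \<and> monic P}" "irreducible Q" "monic Q"
    and "Q dvd (\<Prod>P\<in>A. P ^ e P)"
  shows "Q \<in> A"
proof -
  have Q: "prime_elem Q" using assms(3) by (rule field_poly_irreducible_imp_prime)
  have "\<exists>P\<in>A. Q dvd P ^ e P"
    using assms(1,5)
  proof (induction A rule: finite_induct)
    case empty
    then have "Q dvd 1" by (simp only: prod.empty)
    with irreducible_poly_not_dvd_1[OF assms(3)] show ?case by blast
  next
    case (insert P A)
    then have "Q dvd P ^ e P \<or> Q dvd (\<Prod>P\<in>A. P ^ e P)"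
      using Q by (simp add: prime_elem_dvd_mult_iff)
    with insert.IH show ?case by blast
  qed
  then obtain P where P: "P \<in> A" "Q dvd P ^ e P" by blast
  have "Q dvd P" using prime_elem_dvd_power[OF Q P(2)] .
  moreover have "irreducible P" "monic P" using P(1) assms(2) by auto
  ultimately have "P dvd Q"
    using irreducibleD'[of P Q] irreducible_poly_not_dvd_1[OF assms(3)] by blast
  with \<open>Q dvd P\<close> have "Q = P"
    using \<open>monic P\<close> assms(4) poly_dvd_antisym[of Q P] by simp
  with P(1) show ?thesis by simp
qed

text \<open>Powers of distinct monic irreducible polynomials are coprime.\<close>
lemma prod_prime_powers_dvd_iff:
  fixes A :: "'a::field poly set"
  assumes "finite A" "A \<subseteq> {P. irreducible P \<and> monic P}"
  shows "(\<Prod>P\<in>A. P ^ e P) dvd f \<longleftrightarrow> (\<forall>P\<in>A. P ^ e P dvd f)"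
  using assms
proof (induction A rule: finite_induct)
  case (insert Q A)
  have "Q ^ e Q * (\<Prod>P\<in>A. P ^ e P) dvd f"
    if Q: "Q ^ e Q dvd f" and A: "(\<Prod>P\<in>A. P ^ e P) dvd f"
  proof -
    obtain h where h: "f = (\<Prod>P\<in>A. P ^ e P) * h" using A by blast
    have "\<not> Q dvd (\<Prod>P\<in>A. P ^ e P)"
      using monic_irreducible_dvd_prodD[of A Q e] insert by auto
    moreover have "prime_elem Q"
      using insert.prems by (auto intro: field_poly_irreducible_imp_prime)
    ultimately have "Q ^ e Q dvd h"
      using prime_power_dvd_multD[of Q "e Q" "\<Prod>P\<in>A. P ^ e P" h] Q h
      by (cases "e Q = 0") auto
    then show ?thesis unfolding h by (simp add: mult.commute mult_dvd_mono)
  qed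
  moreover have "(\<Prod>P\<in>A. P ^ e P) dvd f \<longleftrightarrow> (\<forall>P\<in>A. P ^ e P dvd f)"
    using insert by simp
  ultimately show ?case
    using insert.hyps by (auto dest: dvd_mult_left dvd_mult_right)
qed simp

lemma monic_irreducible_dvd_exists:
  fixes r :: "'a::field poly"
  assumes "r \<noteq> 0" "\<not> r dvd 1"
  obtains P where "irreducible P" "monic P" "P dvd r"
proof -
  define h where "h = smult (inverse (lead_coeff r)) r"
  have h: "monic h" "h dvd r" "r dvd h"
    using assms(1) by (auto simp: h_def smult_dvd_iff dvd_smult)
  obtain A e where A: "finite A" "h = (\<Prod>P\<in>A. P ^ Suc (e P))" "A \<subseteq> {P. irreducible P \<and> monic P}"
    using monic_irreducible_factorization[OF h(1)] by metis
  have "h \<noteq> 1" using h(3) assms(2) by metis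
  with A(2) have "A \<noteq> {}" by auto
  then obtain P where P: "P \<in> A" by blast
  have "P dvd P ^ Suc (e P)" by simp
  also have "\<dots> dvd h" unfolding A(2) using A(1) P by (rule dvd_prodI)
  finally have "P dvd r" using h(2) by (rule dvd_trans)
  then show ?thesis using that P A(3) by auto
qed

lemma monic_eq_1_iff_no_irreducible_dvd:
  fixes A :: "'a::field poly set"
  assumes "finite A" "A \<subseteq> {P. irreducible P \<and> monic P}"
    and "monic h" "h dvd (\<Prod>P\<in>A. P ^ e P)"
  shows "h = 1 \<longleftrightarrow> (\<forall>P\<in>A. \<not> P dvd h)"
proof
  assume "h = 1"
  then show "\<forall>P\<in>A. \<not> P dvd h" using assms(2) irreducible_poly_not_dvd_1 by blast
next
  assume *: "\<forall>P\<in>A. \<not> P dvd h"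
  show "h = 1"
  proof (rule ccontr)
    assume "h \<noteq> 1"
    then have "h \<noteq> 0" "\<not> h dvd 1"
      using assms(3) poly_dvd_antisym[of h 1] by auto
    then obtain P where P: "irreducible P" "monic P" "P dvd h"
      by (rule monic_irreducible_dvd_exists)
    have "P \<in> A"
      using assms(1,2) P(1,2) dvd_trans[OF P(3) assms(4)]
      by (rule monic_irreducible_dvd_prodD)
    with * P(3) show False by blast
  qed
qed

lemma monic_right_factor:
  fixes a b :: "'a::field poly"
  assumes "monic (a * b)" "monic a"
  shows "monic b"
  using assms by (simp add: lead_coeff_mult)

lemma monic_prod_powers:
  fixes A :: "'a::field poly set"
  assumes "A \<subseteq> {P. irreducible P \<and> monic P}"
  shows "monic (\<Prod>P\<in>A. P ^ e P)"
  using assms by (intro monic_prod) (auto intro: monic_power)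

lemma degree_prod_powers:
  fixes A :: "'a::field poly set"
  assumes "A \<subseteq> {P. irreducible P \<and> monic P}"
  shows "degree (\<Prod>P\<in>A. P ^ e P) = (\<Sum>P\<in>A. e P * degree P)"
proof -
  have "degree (\<Prod>P\<in>A. P ^ e P) = (\<Sum>P\<in>A. degree (P ^ e P))"
    by (rule degree_prod_eq_sum_degree) (use assms in auto)
  also have "\<dots> = (\<Sum>P\<in>A. e P * degree P)"
    using assms by (intro sum.cong refl Polynomial.degree_power_eq) auto
  finally show ?thesis .
qed

lemma coprime_prod_powers_iff:
  fixes A :: "'a::field poly set"
  assumes "finite A" "A \<subseteq> {P. irreducible P \<and> monic P}"
  shows "coprime h (\<Prod>P\<in>A. P ^ Suc (a P)) \<longleftrightarrow> (\<forall>P\<in>A. \<not> P dvd h)"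
proof
  assume c: "coprime h (\<Prod>P\<in>A. P ^ Suc (a P))"
  show "\<forall>P\<in>A. \<not> P dvd h"
  proof (intro ballI notI)
    fix P assume P: "P \<in> A" "P dvd h"
    have "P dvd P ^ Suc (a P)" by simp
    also have "\<dots> dvd (\<Prod>P\<in>A. P ^ Suc (a P))" using assms(1) P(1) by (rule dvd_prodI)
    finally have "P dvd 1" using c P(2) unfolding coprime_def' by blast
    then show False using P(1) assms(2) irreducible_poly_not_dvd_1 by blast
  qed
next
  assume *: "\<forall>P\<in>A. \<not> P dvd h"
  show "coprime h (\<Prod>P\<in>A. P ^ Suc (a P))"
  proof (rule coprimeI)
    fix r assume r: "r dvd h" "r dvd (\<Prod>P\<in>A. P ^ Suc (a P))"
    have "(\<Prod>P\<in>A. P ^ Suc (a P)) \<noteq> 0"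
      using monic_prod_powers[OF assms(2)] by (metis leading_coeff_0_iff zero_neq_one)
    with r(2) have "r \<noteq> 0" by auto
    show "r dvd 1"
    proof (rule ccontr)
      assume "\<not> r dvd 1"
      with \<open>r \<noteq> 0\<close> obtain P where P: "irreducible P" "monic P" "P dvd r"
        by (rule monic_irreducible_dvd_exists)
      have "P \<in> A"
        using assms P(1,2) dvd_trans[OF P(3) r(2)] by (rule monic_irreducible_dvd_prodD)
      moreover have "P dvd h" using P(3) r(1) by (rule dvd_trans)
      ultimately show False using * by blast
    qed
  qed
qed

text \<open>
  A monic squarefree divisor is the product of the primes that divide it, and every set of prime
  factors occurs.
\<close>
lemma card_squarefree_divisors:
  fixes A :: "'a::field poly set"
  assumes "finite A" "A \<subseteq> {P. irreducible P \<and> monic P}"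
  shows "card {d. monic d \<and> squarefree d \<and> d dvd (\<Prod>P\<in>A. P ^ Suc (a P))} = 2 ^ card A"
proof -
  let ?g = "\<Prod>P\<in>A. P ^ Suc (a P)"
  have mem: "P dvd \<Prod>T \<longleftrightarrow> P \<in> T" if "T \<subseteq> A" "P \<in> A" for T P
  proof
    assume "P dvd \<Prod>T"
    then show "P \<in> T"
      using monic_irreducible_dvd_prodD[of T P "\<lambda>_. 1"] that assms
      by (auto dest: finite_subset)
  next
    assume "P \<in> T"
    then show "P dvd \<Prod>T"
      using that(1) assms(1) dvd_prodI[of T P "\<lambda>P. P"] by (auto dest: finite_subset)
  qed
  have "bij_betw (\<lambda>T. \<Prod>T) (Pow A) {d. monic d \<and> squarefree d \<and> d dvd ?g}"
  proof (rule bij_betwI[where g = "\<lambda>d. {P \<in> A. P dvd d}"])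
    show "(\<lambda>T. \<Prod>T) \<in> Pow A \<rightarrow> {d. monic d \<and> squarefree d \<and> d dvd ?g}"
    proof (intro Pi_I CollectI conjI)
      fix T assume "T \<in> Pow A"
      then have T: "T \<subseteq> A" "finite T" using assms(1) finite_subset by auto
      have T': "T \<subseteq> {P. irreducible P \<and> monic P}" using T assms by auto
      show m: "monic (\<Prod>T)" using monic_prod_powers[OF T', of "\<lambda>_. 1"] by simp
      have "\<Prod>T dvd (\<Prod>P\<in>T. P ^ Suc (a P))" by (rule prod_dvd_prod) simp
      also have "\<dots> dvd ?g" using assms(1) T(1) by (rule prod_dvd_prod_subset)
      finally show "\<Prod>T dvd ?g" .
      show "squarefree (\<Prod>T)"
      proof (rule squarefreeI)
        fix r assume r: "r ^ 2 dvd \<Prod>T"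
        have "r \<noteq> 0" using r m by auto
        show "r dvd 1"
        proof (rule ccontr)
          assume "\<not> r dvd 1"
          with \<open>r \<noteq> 0\<close> obtain P where P: "irreducible P" "monic P" "P dvd r"
            by (rule monic_irreducible_dvd_exists)
          have "P ^ 2 dvd r ^ 2" using P(3) by (rule dvd_power_same)
          then have P2: "P ^ 2 dvd \<Prod>T" using r by (rule dvd_trans)
          then have "P dvd \<Prod>T" unfolding power2_eq_square by (rule dvd_mult_left)
          then have "P \<in> T"
            using monic_irreducible_dvd_prodD[OF T(2) T' P(1,2), of "\<lambda>_. 1"] by simp
          then have "\<Prod>T = P * \<Prod>(T - {P})"
            using T(2) by (simp add: prod.remove)
          with P2 have "P dvd \<Prod>(T - {P})"
            using P(1) by (auto simp: power2_eq_square)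
          then have "P \<in> T - {P}"
            by (intro monic_irreducible_dvd_prodD[OF _ _ P(1,2), of "T - {P}" "\<lambda>_. 1"])
              (use T(2) T' in auto)
          then show False by simp
        qed
      qed
    qed
  next
    show "(\<lambda>d. {P \<in> A. P dvd d}) \<in> {d. monic d \<and> squarefree d \<and> d dvd ?g} \<rightarrow> Pow A" by auto
  next
    fix T assume "T \<in> Pow A"
    then show "{P \<in> A. P dvd \<Prod>T} = T" using mem by auto
  next
    fix d assume "d \<in> {d. monic d \<and> squarefree d \<and> d dvd ?g}"
    then have d: "monic d" "squarefree d" "d dvd ?g" by auto
    let ?T = "{P \<in> A. P dvd d}"
    have T: "finite ?T" "?T \<subseteq> {P. irreducible P \<and> monic P}" using assms by auto
    have "\<Prod>?T dvd d"
      using prod_prime_powers_dvd_iff[OF T, of "\<lambda>_. 1" d] by simp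
    then obtain h where h: "d = \<Prod>?T * h" by blast
    have "monic (\<Prod>?T)" using monic_prod_powers[OF T(2), of "\<lambda>_. 1"] by simp
    then have "monic h" using monic_right_factor d(1) h by metis
    have "\<not> P dvd h" if P: "P \<in> A" for P
    proof
      assume Ph: "P dvd h"
      then have "P dvd d" by (subst h) (rule dvd_mult)
      then have "P dvd \<Prod>?T" using dvd_prodI[OF T(1), of P "\<lambda>P. P"] P by simp
      then have "P * P dvd \<Prod>?T * h" using Ph by (rule mult_dvd_mono)
      then have "P ^ 2 dvd d" by (simp only: power2_eq_square flip: h)
      then have "P dvd 1" using d(2) by (simp add: squarefree_def)
      then show False using P assms(2) irreducible_poly_not_dvd_1 by blast
    qed
    moreover have "h dvd d" by (subst h) (rule dvd_triv_right)
    then have "h dvd ?g" using d(3) by (rule dvd_trans)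
    ultimately have "h = 1"
      using monic_eq_1_iff_no_irreducible_dvd[OF assms \<open>monic h\<close>] by metis
    then show "\<Prod>?T = d" using h by (metis mult_1_right)
  qed
  from bij_betw_same_card[OF this] show ?thesis
    unfolding card_Pow[OF assms(1)] by (rule sym)
qed

section \<open>Sums over polynomials of bounded degree\<close>

text \<open>
  The polynomials of degree less than \<open>M\<close> with $\deg 0 = -\infty$, so that there are $q^M$ of
  them also for \<open>M = 0\<close>.
\<close>
definition polys_below :: "nat \<Rightarrow> 'a::zero poly set" where
  "polys_below M = {f. \<forall>i\<ge>M. coeff f i = 0}"

lemma polys_below_conv_degree: "polys_below M = {f. f = 0 \<or> degree f < M}"
proof (intro Set.set_eqI iffI; unfold polys_below_def mem_Collect_eq)
  fix f :: "'a poly" assume "\<forall>i\<ge>M. coeff f i = 0"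
  then show "f = 0 \<or> degree f < M" by (metis leading_coeff_0_iff linorder_not_le)
qed (auto simp: coeff_eq_0)

lemma degree_less_conv_polys_below: "M > 0 \<Longrightarrow> {f. degree f < M} = polys_below M"
  by (auto simp: polys_below_conv_degree)

lemma finite_card_polys_below:
  "finite (polys_below M :: 'a::{finite,zero} poly set) \<and>
   card (polys_below M :: 'a poly set) = CARD('a) ^ M"
proof (induction M)
  case 0
  have "polys_below 0 = {0 :: 'a poly}" by (auto simp: polys_below_def poly_eq_iff)
  then show ?case by simp
next
  case (Suc M)
  have eq: "polys_below (Suc M) = (\<lambda>(c, f). pCons c f) ` (UNIV \<times> polys_below M :: ('a \<times> 'a poly) set)"
  proof (intro Set.set_eqI iffI)
    fix f :: "'a poly" assume f: "f \<in> polys_below (Suc M)"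
    obtain c g where "f = pCons c g" using pCons_cases by blast
    have "coeff g i = 0" if "i \<ge> M" for i
    proof -
      have "coeff f (Suc i) = 0" using f that by (simp add: polys_below_def)
      then show ?thesis using \<open>f = pCons c g\<close> by simp
    qed
    then have "g \<in> polys_below M" by (simp add: polys_below_def)
    with \<open>f = pCons c g\<close> show "f \<in> (\<lambda>(c, f). pCons c f) ` (UNIV \<times> polys_below M)"
      by (intro image_eqI[of _ _ "(c, g)"]) simp_all
  next
    fix f :: "'a poly" assume "f \<in> (\<lambda>(c, f). pCons c f) ` (UNIV \<times> polys_below M)"
    then obtain c g where "f = pCons c g" "g \<in> polys_below M" by auto
    then show "f \<in> polys_below (Suc M)"
      unfolding polys_below_def by (auto simp: coeff_pCons split: nat.split)
  qed
  have inj: "inj_on (\<lambda>(c, f). pCons c f) (UNIV \<times> polys_below M :: ('a \<times> 'a poly) set)"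
    by (auto simp: inj_on_def)
  show ?case unfolding eq card_image[OF inj] using Suc by (simp add: card_cartesian_product)
qed

lemmas finite_polys_below [simp] = finite_card_polys_below[THEN conjunct1]
  and card_polys_below = finite_card_polys_below[THEN conjunct2]

lemma card_multiples_below:
  fixes d :: "'a::{finite,field} poly"
  assumes "monic d" "degree d \<le> M"
  shows "card {f \<in> polys_below M. d dvd f} = CARD('a) ^ (M - degree d)"
proof -
  have d0: "d \<noteq> 0" using assms(1) by auto
  have mem: "d * k \<in> polys_below M \<longleftrightarrow> k \<in> polys_below (M - degree d)" for k
    using assms(2) d0 by (cases "k = 0") (auto simp: polys_below_conv_degree degree_mult_eq)
  then have "{f \<in> polys_below M. d dvd f} = (*) d ` polys_below (M - degree d)"
    by (auto simp: dvd_def)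
  moreover have "inj_on ((*) d) (polys_below (M - degree d))" using d0 by (auto simp: inj_on_def)
  ultimately show ?thesis by (simp add: card_image card_polys_below)
qed

lemma prod_of_bool:
  "finite S \<Longrightarrow> (\<Prod>x\<in>S. of_bool (p x)) = (of_bool (\<forall>x\<in>S. p x) :: 'c::comm_ring_1)"
  by (induction S rule: finite_induct) auto

text \<open>
  Expanding the product of two-term factors chooses, for each prime \<open>P\<close>, one of its two
  exponents; divisibility by powers of different primes is divisibility by their product, so every
  summand is a weighted indicator of divisibility by a single polynomial. This is the form in which
  both character sums and counts over \<open>f\<close> can be evaluated.
\<close>
lemma prod_two_exponents:
  fixes A :: "'a::field poly set" and u v :: "'a poly \<Rightarrow> 'c::comm_ring_1"
  assumes "finite A" "A \<subseteq> {P. irreducible P \<and> monic P}"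
  shows "(\<Prod>P\<in>A. u P * of_bool (P ^ b P dvd f) + v P * of_bool (P ^ c P dvd f)) =
    (\<Sum>T\<in>Pow A. (\<Prod>P\<in>T. u P) * (\<Prod>P\<in>A - T. v P) *
        of_bool ((\<Prod>P\<in>A. P ^ (if P \<in> T then b P else c P)) dvd f))"
    (is "_ = (\<Sum>T\<in>Pow A. ?r T)")
proof -
  have "(\<Prod>P\<in>T. u P * of_bool (P ^ b P dvd f)) * (\<Prod>P\<in>A - T. v P * of_bool (P ^ c P dvd f)) = ?r T"
    if T: "T \<in> Pow A" for T
  proof -
    have fin: "finite T" "finite (A - T)" using T assms(1) finite_subset by auto
    have "(\<Prod>P\<in>A. P ^ (if P \<in> T then b P else c P)) dvd f \<longleftrightarrow>
        (\<forall>P\<in>T. P ^ b P dvd f) \<and> (\<forall>P\<in>A - T. P ^ c P dvd f)"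
      unfolding prod_prime_powers_dvd_iff[OF assms] using T by auto
    then show ?thesis
      by (simp add: prod.distrib prod_of_bool fin of_bool_conj mult_ac)
  qed
  then show ?thesis by (simp add: prod_add assms(1))
qed

text \<open>
  The events \<open>P ^ e dvd f\<close> for different primes \<open>P\<close> are independent for a uniformly random
  \<open>f\<close> of degree less than \<open>M\<close>: a divisor \<open>d\<close> of degree at most \<open>M\<close> has density exactly
  $q^{-\deg d}$, and this is multiplicative in \<open>d\<close>. The expectation of the product is thus the
  product of the expectations.
\<close>
lemma sum_prod_two_exponents:
  fixes A :: "'a::{finite,field} poly set" and u v :: "'a poly \<Rightarrow> real"
  assumes "finite A" "A \<subseteq> {P. irreducible P \<and> monic P}"
    and "\<And>P. P \<in> A \<Longrightarrow> b P \<le> c P" "degree (\<Prod>P\<in>A. P ^ c P) \<le> M"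
  shows "(\<Sum>f\<in>polys_below M.
      \<Prod>P\<in>A. u P * of_bool (P ^ b P dvd f) + v P * of_bool (P ^ c P dvd f)) =
    real CARD('a) ^ M *
      (\<Prod>P\<in>A. u P / real CARD('a) ^ (b P * degree P) + v P / real CARD('a) ^ (c P * degree P))"
proof -
  let ?q = "real CARD('a)"
  have q: "?q > 0" by simp
  define e where "e T P = (if P \<in> T then b P else c P)" for T and P :: "'a poly"
  let ?d = "\<lambda>T. \<Prod>P\<in>A. P ^ e T P"
  have *: "(\<Prod>P\<in>T. u P) * (\<Prod>P\<in>A - T. v P) * (\<Sum>f\<in>polys_below M. of_bool (?d T dvd f)) =
      ?q ^ M * ((\<Prod>P\<in>T. u P / ?q ^ (b P * degree P)) * (\<Prod>P\<in>A - T. v P / ?q ^ (c P * degree P)))"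
    if T: "T \<in> Pow A" for T
  proof -
    have "degree (?d T) \<le> degree (\<Prod>P\<in>A. P ^ c P)"
      unfolding degree_prod_powers[OF assms(2)]
      using assms(3) by (intro sum_mono) (auto simp: e_def)
    then have deg: "degree (?d T) \<le> M" using assms(4) by simp
    have "(\<Sum>f\<in>polys_below M. of_bool (?d T dvd f)) = real (card {f \<in> polys_below M. ?d T dvd f})"
      by (simp add: sum_of_bool_eq Collect_conj_eq)
    also have "\<dots> = ?q ^ M / ?q ^ degree (?d T)"
      using q deg
      by (simp only: card_multiples_below[OF monic_prod_powers[OF assms(2)] deg] of_nat_power)
        (simp add: power_diff)
    also have "?q ^ degree (?d T) = (\<Prod>P\<in>A. ?q ^ (e T P * degree P))"
      by (simp add: degree_prod_powers[OF assms(2)] power_sum)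
    also have "\<dots> = (\<Prod>P\<in>T. ?q ^ (e T P * degree P)) * (\<Prod>P\<in>A - T. ?q ^ (e T P * degree P))"
      using T assms(1) by (simp add: prod.subset_diff mult.commute)
    also have "\<dots> = (\<Prod>P\<in>T. ?q ^ (b P * degree P)) * (\<Prod>P\<in>A - T. ?q ^ (c P * degree P))"
      by (intro arg_cong2[where f = "(*)"] prod.cong) (auto simp: e_def)
    finally show ?thesis by (simp add: prod_dividef)
  qed
  have "(\<Sum>f\<in>polys_below M.
      \<Prod>P\<in>A. u P * of_bool (P ^ b P dvd f) + v P * of_bool (P ^ c P dvd f)) =
    (\<Sum>T\<in>Pow A. (\<Prod>P\<in>T. u P) * (\<Prod>P\<in>A - T. v P) * (\<Sum>f\<in>polys_below M. of_bool (?d T dvd f)))"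
    unfolding prod_two_exponents[OF assms(1,2)] e_def sum_distrib_left by (rule sum.swap)
  also have "\<dots> = (\<Sum>T\<in>Pow A. ?q ^ M *
      ((\<Prod>P\<in>T. u P / ?q ^ (b P * degree P)) * (\<Prod>P\<in>A - T. v P / ?q ^ (c P * degree P))))"
    by (rule sum.cong[OF refl *])
  also have "\<dots> = ?q ^ M * (\<Sum>T\<in>Pow A.
      (\<Prod>P\<in>T. u P / ?q ^ (b P * degree P)) * (\<Prod>P\<in>A - T. v P / ?q ^ (c P * degree P)))"
    by (rule sum_distrib_left[symmetric])
  finally show ?thesis by (simp only: prod_add[OF assms(1)])
qed

text \<open>
  Coprimality to \<open>g\<close> is avoidance of its primes, and $[P \nmid h] = [P^0 \mid h] - [P^1 \mid h]$ has
  the shape of a two-exponent factor.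
\<close>
lemma poly_phi_prod_powers:
  fixes A :: "'k::{finite,field} poly set"
  assumes A: "finite A" "A \<subseteq> {P. irreducible P \<and> monic P}"
    and g: "g = (\<Prod>P\<in>A. P ^ Suc (a P))"
  shows "real (poly_phi g) =
    real CARD('k) ^ degree g * (\<Prod>P\<in>A. 1 - 1 / real CARD('k) ^ degree P)"
proof -
  have deg: "degree (\<Prod>P\<in>A. P ^ 1) \<le> degree g"
    unfolding g degree_prod_powers[OF A(2)] by (rule sum_mono) simp
  have "real (poly_phi g) = (\<Sum>h\<in>polys_below (degree g). of_bool (coprime h g))"
    by (simp only: poly_phi_def Collect_conj_eq polys_below_conv_degree[symmetric])
      (simp add: sum_of_bool_eq)
  also have "\<dots> = (\<Sum>h\<in>polys_below (degree g).
      \<Prod>P\<in>A. 1 * of_bool (P ^ 0 dvd h) + (- 1) * of_bool (P ^ 1 dvd h))"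
  proof (rule sum.cong[OF refl])
    fix h :: "'k poly"
    have "of_bool (coprime h g) = (\<Prod>P\<in>A. of_bool (\<not> P dvd h) :: real)"
      unfolding g coprime_prod_powers_iff[OF A] prod_of_bool[OF A(1)] ..
    also have "\<dots> = (\<Prod>P\<in>A. 1 * of_bool (P ^ 0 dvd h) + (- 1) * of_bool (P ^ 1 dvd h))"
      by (rule prod.cong) auto
    finally show "of_bool (coprime h g) =
        (\<Prod>P\<in>A. 1 * of_bool (P ^ 0 dvd h) + (- 1) * of_bool (P ^ 1 dvd h) :: real)" .
  qed
  also have "\<dots> = real CARD('k) ^ degree g *
      (\<Prod>P\<in>A. 1 / real CARD('k) ^ (0 * degree P) + - 1 / real CARD('k) ^ (1 * degree P))"
    by (rule sum_prod_two_exponents[OF A _ deg]) simp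
  finally show ?thesis by simp
qed

section \<open>Additive characters\<close>

text \<open>The annihilator of \<open>H\<close> in the dual group.\<close>
definition trivial_on :: "'l::{finite,field} set \<Rightarrow> ('l \<Rightarrow> complex) set" where
  "trivial_on H = {\<chi>. additive_character \<chi> \<and> (\<forall>x\<in>H. \<chi> x = 1)}"

definition add_subgroup :: "'l::ab_group_add set \<Rightarrow> bool" where
  "add_subgroup H \<longleftrightarrow> 0 \<in> H \<and> (\<forall>x\<in>H. \<forall>y\<in>H. x - y \<in> H)"

lemma add_subgroup_add: "add_subgroup H \<Longrightarrow> x \<in> H \<Longrightarrow> y \<in> H \<Longrightarrow> x + y \<in> H"
  unfolding add_subgroup_def by (metis diff_0 diff_minus_eq_add)

lemma add_subgroup_of_int_mult:
  fixes H :: "'l::comm_ring_1 set"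
  assumes "add_subgroup H" "x \<in> H"
  shows "of_int i * x \<in> H"
proof (induction i rule: int_induct[where k = 0])
  case base
  then show ?case using assms(1) by (simp add: add_subgroup_def)
next
  case (step1 i)
  then show ?case using add_subgroup_add[OF assms(1) step1(2) assms(2)] by (simp add: algebra_simps)
next
  case (step2 i)
  then have "of_int i * x - x \<in> H" using assms by (simp add: add_subgroup_def)
  then show ?case by (simp add: algebra_simps)
qed

lemma additive_character_add: "additive_character \<chi> \<Longrightarrow> \<chi> (x + y) = \<chi> x * \<chi> y"
  and additive_character_nonzero: "additive_character \<chi> \<Longrightarrow> \<chi> x \<noteq> 0"
  by (auto simp: additive_character_def)

lemma additive_character_0: "additive_character \<chi> \<Longrightarrow> \<chi> 0 = 1"
  using additive_character_add[of \<chi> 0 0] additive_character_nonzero[of \<chi> 0] by simp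

lemma additive_character_minus: "additive_character \<chi> \<Longrightarrow> \<chi> (- x) = inverse (\<chi> x)"
  using additive_character_add[of \<chi> x "- x"] additive_character_0[of \<chi>]
  by (simp add: inverse_unique)

lemma additive_character_diff: "additive_character \<chi> \<Longrightarrow> \<chi> (x - y) = \<chi> x / \<chi> y"
  using additive_character_add[of \<chi> x "- y"] by (simp add: additive_character_minus divide_inverse)

lemma additive_character_of_nat_mult:
  "additive_character \<chi> \<Longrightarrow> \<chi> (of_nat n * x) = \<chi> x ^ n"
  by (induction n) (simp_all add: additive_character_0 additive_character_add algebra_simps)

lemma finite_additive_characters:
  "finite {\<chi> :: 'l::{finite,field} \<Rightarrow> complex. additive_character \<chi>}"
proof -
  let ?p = "CHAR('l)"
  have p: "?p > 0" by (rule finite_imp_CHAR_pos) simp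
  have "\<chi> x ^ ?p = 1" if "additive_character \<chi>" for \<chi> :: "'l \<Rightarrow> complex" and x
    using additive_character_of_nat_mult[OF that, of ?p x]
    by (simp only: of_nat_CHAR mult_zero_left additive_character_0[OF that])
  then have "{\<chi> :: 'l \<Rightarrow> complex. additive_character \<chi>} \<subseteq>
      {\<chi>. \<forall>x. (x \<in> UNIV \<longrightarrow> \<chi> x \<in> {z. z ^ ?p = 1}) \<and> (x \<notin> UNIV \<longrightarrow> \<chi> x = 0)}"
    by auto
  moreover have "finite {z :: complex. z ^ ?p = 1}"
    using p by (intro finite_roots_unity) simp
  ultimately show ?thesis
    by (intro finite_subset[OF _ finite_set_of_finite_funs[of UNIV "{z :: complex. z ^ ?p = 1}" 0]])
      simp_all
qed

lemma finite_trivial_on [simp]: "finite (trivial_on H)"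
  unfolding trivial_on_def by (rule finite_subset[OF _ finite_additive_characters]) auto

text \<open>
  Choose a subgroup \<open>M\<close> containing \<open>H\<close> that is maximal among those avoiding \<open>y\<close>. Since
  \<open>p\<close> times anything vanishes for the prime characteristic \<open>p\<close>, maximality forces every
  \<open>z\<close> to be congruent to a multiple \<open>i y\<close> modulo \<open>M\<close>, with \<open>i\<close> unique modulo \<open>p\<close>. Thus the
  quotient by \<open>M\<close> is cyclic of order \<open>p\<close>, and sending \<open>y\<close> to a primitive \<open>p\<close>-th root
  of unity defines a character of it.
\<close>
lemma exists_character_separating:
  fixes H :: "'l::{finite,field} set"
  assumes H: "add_subgroup H" and y: "y \<notin> H"
  obtains \<chi> where "\<chi> \<in> trivial_on H" "\<chi> y \<noteq> 1"
proof -
  let ?p = "CHAR('l)"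
  let ?F = "{M. add_subgroup M \<and> H \<subseteq> M \<and> y \<notin> M}"
  have "prime ?p" by (intro prime_CHAR_semidom finite_imp_CHAR_pos) simp
  then have p: "prime (int ?p)" by simp
  have "finite ?F" "?F \<noteq> {}" using assms by auto
  from finite_has_maximal[OF this]
  obtain M where M: "M \<in> ?F" and max: "\<forall>N\<in>?F. M \<subseteq> N \<longrightarrow> M = N"
    by (elim bexE)
  then have M': "add_subgroup M" "H \<subseteq> M" "y \<notin> M" by auto
  have mult_mem: "of_int i * y \<in> M \<longleftrightarrow> int ?p dvd i" for i
  proof
    assume i: "of_int i * y \<in> M"
    show "int ?p dvd i"
    proof (rule ccontr)
      assume "\<not> int ?p dvd i"
      then have "coprime (int ?p) i" using p by (simp add: prime_imp_coprime)
      then obtain a b where ab: "a * int ?p + b * i = 1" using bezout_int[of "int ?p" i] by auto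
      have "y = of_int (a * int ?p + b * i) * y" by (simp add: ab)
      also have "\<dots> = of_int b * (of_int i * y)" by (simp add: algebra_simps)
      also have "\<dots> \<in> M" using M'(1) i by (rule add_subgroup_of_int_mult)
      finally show False using M'(3) by contradiction
    qed
  next
    assume "int ?p dvd i"
    then have "(of_int i :: 'l) = 0" by (simp add: of_int_eq_0_iff_char_dvd)
    then show "of_int i * y \<in> M" using M'(1) by (simp add: add_subgroup_def)
  qed
  have cover: "\<exists>i::int. z - of_int i * y \<in> M" for z
  proof (cases "z \<in> M")
    case True
    then show ?thesis by (intro exI[of _ 0]) simp
  next
    case z: False
    \<comment> \<open>The subgroup generated by \<open>M\<close> and \<open>z\<close>; by maximality it contains \<open>y\<close>.\<close>
    let ?N = "{x. \<exists>j::int. x - of_int j * z \<in> M}"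
    have "add_subgroup ?N"
      unfolding add_subgroup_def
    proof (intro conjI ballI)
      show "0 \<in> ?N" using M'(1) by (auto simp: add_subgroup_def intro: exI[of _ 0])
      fix x x' assume "x \<in> ?N" "x' \<in> ?N"
      then obtain j j' where "x - of_int j * z \<in> M" "x' - of_int j' * z \<in> M" by auto
      then have "(x - of_int j * z) - (x' - of_int j' * z) \<in> M"
        using M'(1) by (simp add: add_subgroup_def)
      then show "x - x' \<in> ?N" by (auto simp: algebra_simps intro!: exI[of _ "j - j'"])
    qed
    moreover have "M \<subseteq> ?N" by (auto intro: exI[of _ 0])
    moreover have "z \<in> ?N" using M'(1) by (auto simp: add_subgroup_def intro!: exI[of _ 1])
    ultimately have "y \<in> ?N" using max M'(2) z by blast
    then obtain j where j: "y - of_int j * z \<in> M" by auto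
    have "\<not> int ?p dvd j"
    proof
      assume "int ?p dvd j"
      then have "(of_int j :: 'l) = 0" by (simp add: of_int_eq_0_iff_char_dvd)
      with j M'(3) show False by simp
    qed
    then have "coprime (int ?p) j" using p by (simp add: prime_imp_coprime)
    then obtain a b where ab: "a * int ?p + b * j = 1" using bezout_int[of "int ?p" j] by auto
    have "z - of_int b * y = of_int (a * int ?p + b * j) * z - of_int b * y" by (simp add: ab)
    also have "\<dots> = of_int (- b) * (y - of_int j * z)" by (simp add: algebra_simps)
    also have "\<dots> \<in> M" using M'(1) j by (rule add_subgroup_of_int_mult)
    finally show ?thesis by blast
  qed
  \<comment> \<open>The coordinate along \<open>y\<close>; it is determined only modulo \<open>p\<close>, which is all that the
    character sees.\<close>
  define \<iota> where "\<iota> z = (SOME i::int. z - of_int i * y \<in> M)" for z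
  have \<iota>: "z - of_int (\<iota> z) * y \<in> M" for z
    unfolding \<iota>_def by (rule someI_ex[OF cover])
  define \<chi> where "\<chi> z = cis (2 * pi * of_int (\<iota> z) / real ?p)" for z
  have p0: "?p > 0" by (rule finite_imp_CHAR_pos) simp
  have eq: "\<chi> z = cis (2 * pi * of_int i / real ?p)" if "z - of_int i * y \<in> M" for z i
  proof -
    have "(z - of_int i * y) - (z - of_int (\<iota> z) * y) \<in> M"
      using M'(1) that \<iota>[of z] unfolding add_subgroup_def by blast
    moreover have "(z - of_int i * y) - (z - of_int (\<iota> z) * y) = of_int (\<iota> z - i) * y"
      by (simp add: algebra_simps)
    ultimately have "of_int (\<iota> z - i) * y \<in> M" by (simp only:)
    then obtain k where k: "\<iota> z - i = int ?p * k" using mult_mem by blast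
    then have "\<iota> z = i + int ?p * k" by simp
    then have "2 * pi * of_int (\<iota> z) / real ?p = 2 * pi * of_int i / real ?p + 2 * pi * of_int k"
      using p0 by (simp add: field_simps)
    then show ?thesis unfolding \<chi>_def by (simp flip: cis_mult)
  qed
  have "additive_character \<chi>"
    unfolding additive_character_def
  proof (intro conjI allI)
    fix u v
    show "\<chi> u \<noteq> 0" by (simp add: \<chi>_def)
    have "(u - of_int (\<iota> u) * y) + (v - of_int (\<iota> v) * y) \<in> M"
      using M'(1) \<iota> \<iota> by (rule add_subgroup_add)
    then have "(u + v) - of_int (\<iota> u + \<iota> v) * y \<in> M" by (simp add: algebra_simps)
    from eq[OF this] show "\<chi> (u + v) = \<chi> u * \<chi> v"
      unfolding \<chi>_def cis_mult by (simp add: add_divide_distrib distrib_left)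
  qed
  moreover have "\<chi> x = 1" if "x \<in> H" for x using eq[of x 0] M'(2) that by auto
  moreover have "\<chi> y \<noteq> 1"
  proof
    assume *: "\<chi> y = 1"
    have "\<chi> y = cis (2 * pi / real ?p)"
      using eq[of y 1] M'(1) by (simp add: add_subgroup_def)
    with * have "cos (2 * pi / real ?p) = 1" by (simp add: complex_eq_iff)
    then obtain n :: int where "2 * pi / real ?p = real_of_int n * 2 * pi"
      unfolding cos_one_2pi_int by auto
    then have "1 = real_of_int n * real ?p" using p0 by (simp add: field_simps)
    then have "1 = n * int ?p" by (metis of_int_1 of_int_eq_iff of_int_mult of_int_of_nat_eq)
    then have "int ?p dvd 1" by (metis dvd_triv_right)
    with p show False by (simp add: not_prime_unit)
  qed
  ultimately show ?thesis using that unfolding trivial_on_def by blast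
qed

text \<open>
  If \<open>y\<close> lies outside \<open>H\<close>, multiplying all characters by one that separates \<open>y\<close> from \<open>H\<close>
  permutes the summands but multiplies the sum by a constant other than 1.
\<close>
lemma sum_trivial_on:
  fixes H :: "'l::{finite,field} set"
  assumes "add_subgroup H"
  shows "(\<Sum>\<chi>\<in>trivial_on H. \<chi> y) = of_nat (card (trivial_on H)) * of_bool (y \<in> H)"
proof (cases "y \<in> H")
  case True
  then have "(\<Sum>\<chi>\<in>trivial_on H. \<chi> y) = (\<Sum>\<chi>\<in>trivial_on H. 1)"
    by (intro sum.cong) (auto simp: trivial_on_def)
  then show ?thesis using True by simp
next
  case False
  obtain \<psi> where \<psi>: "\<psi> \<in> trivial_on H" "\<psi> y \<noteq> 1"
    using exists_character_separating[OF assms False] .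
  have nz: "\<psi> x \<noteq> 0" for x using \<psi>(1) by (simp add: trivial_on_def additive_character_def)
  have "(\<Sum>\<chi>\<in>trivial_on H. \<chi> y) = (\<Sum>\<chi>\<in>trivial_on H. \<psi> y * \<chi> y)"
    by (rule sum.reindex_bij_witness[of _ "\<lambda>\<chi> x. \<psi> x * \<chi> x" "\<lambda>\<chi> x. \<chi> x / \<psi> x"])
      (use \<psi>(1) nz in \<open>auto simp: trivial_on_def additive_character_def\<close>)
  also have "\<dots> = \<psi> y * (\<Sum>\<chi>\<in>trivial_on H. \<chi> y)" by (simp add: sum_distrib_left)
  finally have "(\<Sum>\<chi>\<in>trivial_on H. \<chi> y) = 0" using \<psi>(2) by simp
  with False show ?thesis by simp
qed

lemma sum_additive_character:
  fixes \<chi> :: "'l::{finite,field} \<Rightarrow> complex"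
  assumes "additive_character \<chi>"
  shows "(\<Sum>x\<in>UNIV. \<chi> x) = of_nat CARD('l) * of_bool (\<chi> = (\<lambda>_. 1))"
proof (cases "\<chi> = (\<lambda>_. 1)")
  case False
  then obtain a where a: "\<chi> a \<noteq> 1" by auto
  have "(\<Sum>x\<in>UNIV. \<chi> x) = (\<Sum>x\<in>UNIV. \<chi> (a + x))"
    by (rule sum.reindex_bij_witness[of _ "\<lambda>x. a + x" "\<lambda>x. x - a"]) auto
  also have "\<dots> = \<chi> a * (\<Sum>x\<in>UNIV. \<chi> x)"
    using assms by (simp add: additive_character_def sum_distrib_left)
  finally show ?thesis using a False by simp
qed simp

text \<open>
  Double counting of \<open>\<chi> y\<close> over all these characters \<open>\<chi>\<close> and all group elements \<open>y\<close>: after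
  summation over \<open>y\<close> only the trivial character contributes, after summation over \<open>\<chi>\<close> only the
  elements of \<open>H\<close> do.
\<close>
lemma card_trivial_on:
  fixes H :: "'l::{finite,field} set"
  assumes "add_subgroup H"
  shows "card (trivial_on H) * card H = CARD('l)"
proof -
  have "of_nat (card (trivial_on H) * card H) =
      (\<Sum>y\<in>UNIV. of_nat (card (trivial_on H)) * (of_bool (y \<in> H) :: complex))"
    by (simp add: sum_of_bool_eq flip: sum_distrib_left)
  also have "\<dots> = (\<Sum>y\<in>UNIV. \<Sum>\<chi>\<in>trivial_on H. \<chi> y)"
    using sum_trivial_on[OF assms] by simp
  also have "\<dots> = (\<Sum>\<chi>\<in>trivial_on H. \<Sum>y\<in>UNIV. \<chi> y)" by (rule sum.swap)
  also have "\<dots> = (\<Sum>\<chi>\<in>trivial_on H. of_nat CARD('l) * of_bool (\<chi> = (\<lambda>_. 1)))"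
    by (intro sum.cong refl sum_additive_character) (simp add: trivial_on_def)
  also have "\<dots> = of_nat CARD('l) * of_nat (card (trivial_on H \<inter> {\<lambda>_. 1}))"
    by (simp add: sum_of_bool_eq flip: sum_distrib_left)
  also have "trivial_on H \<inter> {\<lambda>_. 1} = {\<lambda>_. 1}"
    by (auto simp: trivial_on_def additive_character_def)
  finally show ?thesis by (simp flip: of_nat_mult del: of_nat_mult)
qed

section \<open>The action of polynomials on the extension field\<close>

text \<open>Multiplication by a nonzero \<open>x\<close> permutes the nonzero elements.\<close>
lemma finite_field_power_card:
  fixes x :: "'a::{finite,field}"
  shows "x ^ CARD('a) = x"
proof (cases "x = 0")
  case False
  have "(\<Prod>y\<in>UNIV - {0}. y) = (\<Prod>y\<in>UNIV - {0}. x * y)"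
    by (rule prod.reindex_bij_witness[of _ "\<lambda>y. x * y" "\<lambda>y. y / x"]) (use False in auto)
  also have "\<dots> = x ^ (CARD('a) - 1) * (\<Prod>y\<in>UNIV - {0}. y)"
    by (simp add: prod.distrib)
  finally have "x ^ (CARD('a) - 1) = 1" by simp
  then have "x ^ Suc (CARD('a) - 1) = x" by (simp only: power_Suc mult_1_right)
  also have "Suc (CARD('a) - 1) = CARD('a)" using zero_less_card_finite by (rule Suc_diff_1)
  finally show ?thesis .
qed simp

locale finite_field_extension = field_hom emb
  for emb :: "'k::{finite,field} \<Rightarrow> 'l::{finite,field}" +
  fixes q m :: nat
  assumes card_base [simp]: "CARD('k) = q" and card_extension: "CARD('l) = q ^ m"
    and m_pos: "m > 0"
begin

lemma q_pos: "q > 0"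
  using zero_less_card_finite[where 'a = 'k] by simp

lemma emb_power_q: "emb c ^ q = emb c"
  using finite_field_power_card[of c] by (simp flip: hom_power)

text \<open>
  The polynomial $(1+X)^q - X^q - 1$ has degree less than \<open>q\<close>, yet it vanishes at the \<open>q\<close>
  elements of the base field, on which raising to the power \<open>q\<close> is the identity. So it is zero.
  Additivity of the Frobenius map follows by homogeneity.
\<close>
lemma frobenius_add_1:
  fixes x :: 'l
  shows "(x + 1) ^ q = x ^ q + 1"
proof -
  define D :: "'l poly" where "D = [:1, 1:] ^ q - monom 1 q - 1"
  note q = q_pos
  have coeff_D: "coeff D i = 0" if "i \<ge> q" for i
  proof (cases "i = q")
    case True
    then show ?thesis using q by (simp add: D_def coeff_linear_power)
  next
    case False
    then have "coeff ([:1, 1:] ^ q :: 'l poly) i = 0"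
      using that by (intro coeff_eq_0) (simp add: degree_linear_power)
    then show ?thesis using False that q by (simp add: D_def)
  qed
  have "D = 0"
  proof (rule ccontr)
    assume "D \<noteq> 0"
    then have "degree D < q" using coeff_D[of "degree D"] by (metis leading_coeff_0_iff linorder_not_le)
    have "poly D (emb c) = 0" for c
    proof -
      have "(1 + emb c) ^ q = 1 + emb c"
        using emb_power_q[of "1 + c"] by (simp only: hom_add hom_one)
      then show ?thesis by (simp add: D_def poly_monom emb_power_q)
    qed
    then have "range emb \<subseteq> {x. poly D x = 0}" by auto
    then have "card (range emb) \<le> card {x. poly D x = 0}"
      by (intro card_mono) simp_all
    also have "\<dots> \<le> degree D" using \<open>D \<noteq> 0\<close> by (rule card_poly_roots_bound)
    also have "card (range emb) = q" using card_image[OF inj_f] by simp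
    finally show False using \<open>degree D < q\<close> by simp
  qed
  then have "poly D x = 0" by simp
  then have "(1 + x) ^ q - x ^ q - 1 = 0" by (simp only: D_def poly_diff poly_power poly_monom) simp
  then show ?thesis by (simp add: algebra_simps)
qed

lemma frobenius_add:
  fixes x y :: 'l
  shows "(x + y) ^ q = x ^ q + y ^ q"
proof (cases "y = 0")
  case False
  then have "x + y = y * (x / y + 1)" by (simp add: distrib_left)
  then have "(x + y) ^ q = (y * (x / y + 1)) ^ q" by (rule arg_cong)
  also have "\<dots> = y ^ q * ((x / y) ^ q + 1)"
    by (simp only: power_mult_distrib frobenius_add_1)
  also have "\<dots> = x ^ q + y ^ q" using False by (simp add: distrib_left power_divide)
  finally show ?thesis .
qed (simp add: power_0_left q_pos)

lemma qaction_eq_sum: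
  assumes "degree f \<le> N"
  shows "qaction emb f \<gamma> = (\<Sum>i\<le>N. emb (coeff f i) * \<gamma> ^ (q ^ i))"
  unfolding qaction_def card_base
  by (rule sum.mono_neutral_left) (use assms in \<open>auto simp: coeff_eq_0\<close>)

lemma qaction_0 [simp]: "qaction emb 0 \<gamma> = 0"
  by (simp add: qaction_def)

lemma qaction_pCons: "qaction emb (pCons a p) \<gamma> = emb a * \<gamma> + qaction emb p (\<gamma> ^ q)"
proof -
  have "qaction emb (pCons a p) \<gamma> =
      (\<Sum>i\<le>Suc (degree p). emb (coeff (pCons a p) i) * \<gamma> ^ (q ^ i))"
    by (rule qaction_eq_sum) (rule degree_pCons_le)
  also have "\<dots> = emb a * \<gamma> + (\<Sum>i\<le>degree p. emb (coeff p i) * (\<gamma> ^ q) ^ (q ^ i))"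
    by (simp only: sum.atMost_Suc_shift coeff_pCons_0 coeff_pCons_Suc power_0 power_one_right
        power_Suc power_mult)
  finally show ?thesis by (simp add: qaction_def)
qed

lemma qaction_1 [simp]: "qaction emb 1 \<gamma> = \<gamma>"
  by (simp add: one_pCons qaction_pCons)

lemma qaction_add: "qaction emb (f + g) \<gamma> = qaction emb f \<gamma> + qaction emb g \<gamma>"
proof -
  let ?N = "max (degree f) (degree g)"
  have "degree (f + g) \<le> ?N" "degree f \<le> ?N" "degree g \<le> ?N"
    by (auto simp: degree_add_le_max)
  from this[THEN qaction_eq_sum] show ?thesis
    by (simp only: coeff_add hom_add distrib_right sum.distrib)
qed

lemma qaction_diff: "qaction emb (f - g) \<gamma> = qaction emb f \<gamma> - qaction emb g \<gamma>"
  using qaction_add[of "f - g" g \<gamma>] by simp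

lemma qaction_smult: "qaction emb (smult c p) \<gamma> = emb c * qaction emb p \<gamma>"
  by (induction p arbitrary: \<gamma>)
    (simp_all add: qaction_pCons hom_mult algebra_simps)

lemma qaction_add_right: "qaction emb p (x + y) = qaction emb p x + qaction emb p y"
  by (induction p arbitrary: x y)
    (simp_all add: qaction_pCons frobenius_add algebra_simps)

lemma qaction_diff_right: "qaction emb p (x - y) = qaction emb p x - qaction emb p y"
  using qaction_add_right[of p "x - y" y] by simp

lemma qaction_frobenius: "qaction emb p (x ^ q) = qaction emb p x ^ q"
proof (induction p arbitrary: x)
  case (pCons a p)
  then show ?case
    by (simp only: qaction_pCons frobenius_add power_mult_distrib emb_power_q)
qed (simp add: power_0_left q_pos)

text \<open>
  The action makes the extension field a module over the polynomial ring: \<open>X\<close> acts as the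
  Frobenius map, which commutes with the action of every polynomial because the coefficients are
  fixed by it.
\<close>
lemma qaction_mult: "qaction emb (p * r) \<gamma> = qaction emb p (qaction emb r \<gamma>)"
proof (induction p arbitrary: \<gamma>)
  case (pCons a p)
  have "qaction emb (pCons a p * r) \<gamma> = emb a * qaction emb r \<gamma> + qaction emb (p * r) (\<gamma> ^ q)"
    by (simp add: mult_pCons_left qaction_add qaction_smult qaction_pCons)
  also have "qaction emb (p * r) (\<gamma> ^ q) = qaction emb p (qaction emb r \<gamma> ^ q)"
    by (simp only: pCons.IH qaction_frobenius)
  finally show ?case by (simp only: qaction_pCons)
qed simp

abbreviation X_m_1 :: "'k poly" where "X_m_1 \<equiv> monom 1 m - 1"

lemma qaction_monom: "qaction emb (monom 1 n) \<gamma> = \<gamma> ^ (q ^ n)"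
  by (induction n arbitrary: \<gamma>)
    (simp_all add: monom_0 monom_Suc qaction_pCons power_mult)

lemma qaction_X_m_1: "qaction emb X_m_1 \<gamma> = 0"
  using finite_field_power_card[of \<gamma>] by (simp add: qaction_diff qaction_monom card_extension)

lemma coeff_X_m_1: "coeff X_m_1 i = (if i = m then 1 else if i = 0 then - 1 else 0)"
  using m_pos by (auto simp: coeff_1)

lemma degree_X_m_1: "degree X_m_1 = m"
  by (intro antisym degree_le le_degree) (auto simp: coeff_X_m_1 simp del: coeff_diff)

lemma monic_X_m_1: "monic X_m_1"
  unfolding degree_X_m_1 coeff_X_m_1 by simp

lemma degree_dvd_X_m_1: "h dvd X_m_1 \<Longrightarrow> degree h \<le> m"
  using dvd_imp_degree_le[of h X_m_1] monic_X_m_1 unfolding degree_X_m_1 by fastforce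

subsection \<open>Normal elements\<close>

text \<open>
  The conjugates of \<open>\<alpha>\<close> span, so the map is surjective; both sides have $q^m$ elements. Together
  with \<open>qaction_eq_0_iff\<close> below this says that the extension field is free of rank one over the
  ring of polynomials modulo $X^m - 1$, with basis \<open>\<alpha>\<close>.
\<close>
lemma normal_element_bij_betw:
  assumes "normal_element emb m \<alpha>"
  shows "bij_betw (\<lambda>f. qaction emb f \<alpha>) (polys_below m) UNIV"
proof -
  define cj where "cj i = \<alpha> ^ (q ^ i)" for i
  have inj: "inj_on cj {..<m}" and span: "module.span (ext_scale emb) (cj ` {..<m}) = UNIV"
    using assms unfolding normal_element_def Let_def cj_def card_base by auto
  interpret V: vector_space "ext_scale emb"
    by (rule vector_space_ext_scale) unfold_locales
  have "y \<in> (\<lambda>f. qaction emb f \<alpha>) ` polys_below m" for y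
  proof -
    have "y \<in> range (\<lambda>u. \<Sum>v\<in>cj ` {..<m}. ext_scale emb (u v) v)"
      using V.span_finite[of "cj ` {..<m}"] span by simp
    then obtain u where u: "y = (\<Sum>v\<in>cj ` {..<m}. ext_scale emb (u v) v)" by blast
    define f where "f = (\<Sum>i<m. monom (u (cj i)) i)"
    have coeff_f: "coeff f i = (if i < m then u (cj i) else 0)" for i
      by (simp add: f_def coeff_sum)
    have f: "f \<in> polys_below m" by (simp add: polys_below_def coeff_f)
    then have "degree f \<le> m" by (intro degree_le) (simp add: polys_below_def)
    then have "qaction emb f \<alpha> = (\<Sum>i\<le>m. emb (coeff f i) * cj i)"
      unfolding cj_def by (rule qaction_eq_sum)
    also have "\<dots> = (\<Sum>i<m. emb (u (cj i)) * cj i)"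
      by (simp add: coeff_f flip: lessThan_Suc_atMost)
    also have "\<dots> = y"
      unfolding u by (simp add: sum.reindex[OF inj] ext_scale_def)
    finally show ?thesis using f by (intro image_eqI) simp_all
  qed
  then have surj: "(\<lambda>f. qaction emb f \<alpha>) ` polys_below m = UNIV" by blast
  then have "inj_on (\<lambda>f. qaction emb f \<alpha>) (polys_below m)"
    by (intro eq_card_imp_inj_on) (simp_all add: card_polys_below card_extension)
  with surj show ?thesis by (simp add: bij_betw_def)
qed

lemma qaction_eq_0_iff:
  assumes "normal_element emb m \<alpha>"
  shows "qaction emb p \<alpha> = 0 \<longleftrightarrow> X_m_1 dvd p"
proof
  assume p: "qaction emb p \<alpha> = 0"
  have nz: "X_m_1 \<noteq> 0" using monic_X_m_1 by force
  let ?r = "p mod X_m_1"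
  have "p = X_m_1 * (p div X_m_1) + ?r" by simp
  then have "qaction emb p \<alpha> = qaction emb (X_m_1 * (p div X_m_1) + ?r) \<alpha>"
    by (simp only:)
  then have "qaction emb ?r \<alpha> = 0"
    by (simp only: p qaction_add qaction_mult qaction_X_m_1 add_0)
  moreover have "?r \<in> polys_below m"
    using degree_mod_less[OF nz, of p] unfolding polys_below_conv_degree degree_X_m_1 by auto
  moreover have "0 \<in> polys_below m" by (simp add: polys_below_def)
  ultimately have "?r = 0"
    using normal_element_bij_betw[OF assms] unfolding bij_betw_def inj_on_def
    by (metis qaction_0)
  then show "X_m_1 dvd p" by (simp only: mod_eq_0_iff_dvd)
next
  assume "X_m_1 dvd p"
  then obtain s where "p = X_m_1 * s" ..
  then show "qaction emb p \<alpha> = 0" by (simp only: qaction_mult qaction_X_m_1)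
qed

lemma qaction_in_range_iff:
  assumes "normal_element emb m \<alpha>" "h dvd X_m_1"
  shows "qaction emb f \<alpha> \<in> range (qaction emb h) \<longleftrightarrow> h dvd f"
proof
  assume "qaction emb f \<alpha> \<in> range (qaction emb h)"
  then obtain \<gamma> where \<gamma>: "qaction emb f \<alpha> = qaction emb h \<gamma>" by auto
  obtain u where "\<gamma> = qaction emb u \<alpha>"
    using bij_betw_imp_surj_on[OF normal_element_bij_betw[OF assms(1)]] by fast
  with \<gamma> have "qaction emb (f - h * u) \<alpha> = 0" by (simp add: qaction_diff qaction_mult)
  then have "h dvd f - h * u"
    using qaction_eq_0_iff[OF assms(1)] assms(2) dvd_trans by blast
  then have "h dvd (f - h * u) + h * u" by (rule dvd_add) (rule dvd_triv_left)
  then show "h dvd f" by simp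
next
  assume "h dvd f"
  then obtain u where "f = h * u" ..
  then show "qaction emb f \<alpha> \<in> range (qaction emb h)" by (simp add: qaction_mult)
qed

lemma card_range_qaction:
  assumes "normal_element emb m \<alpha>" "h dvd X_m_1" "monic h"
  shows "card (range (qaction emb h)) = q ^ (m - degree h)"
proof -
  note bij = normal_element_bij_betw[OF assms(1)]
  have "range (qaction emb h) = (\<lambda>f. qaction emb f \<alpha>) ` {f \<in> polys_below m. h dvd f}"
  proof (intro subset_antisym subsetI)
    fix y assume y: "y \<in> range (qaction emb h)"
    obtain f where f: "f \<in> polys_below m" "y = qaction emb f \<alpha>"
      using bij_betw_imp_surj_on[OF bij] by fast
    with y have "h dvd f" using qaction_in_range_iff[OF assms(1,2)] by simp
    with f show "y \<in> (\<lambda>f. qaction emb f \<alpha>) ` {f \<in> polys_below m. h dvd f}" by blast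
  next
    fix y assume "y \<in> (\<lambda>f. qaction emb f \<alpha>) ` {f \<in> polys_below m. h dvd f}"
    then show "y \<in> range (qaction emb h)" using qaction_in_range_iff[OF assms(1,2)] by auto
  qed
  moreover have "inj_on (\<lambda>f. qaction emb f \<alpha>) {f \<in> polys_below m. h dvd f}"
    using bij_betw_imp_inj_on[OF bij] by (rule inj_on_subset) auto
  ultimately show ?thesis
    by (simp add: card_image card_multiples_below[OF assms(3) degree_dvd_X_m_1[OF assms(2)]])
qed

lemma trivial_on_range_qaction:
  "trivial_on (range (qaction emb h)) = {\<chi>. additive_character \<chi> \<and> qannihilates emb h \<chi>}"
  by (auto simp: trivial_on_def qannihilates_def)

text \<open>
  The characters annihilated by \<open>h\<close> are those trivial on the submodule $h \circ \mathbb{F}_{q^m}$,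
  which has index $q^{\deg h}$ and contains $f \circ \alpha$ exactly when \<open>h\<close> divides \<open>f\<close>.
\<close>
lemma sum_annihilated_characters:
  assumes "normal_element emb m \<alpha>" "h dvd X_m_1" "monic h"
  shows "(\<Sum>\<chi> | additive_character \<chi> \<and> qannihilates emb h \<chi>. \<chi> (qaction emb f \<alpha>)) =
    of_nat (q ^ degree h) * of_bool (h dvd f)"
proof -
  let ?H = "range (qaction emb h)"
  have H: "add_subgroup ?H"
    unfolding add_subgroup_def
  proof (intro conjI ballI)
    have "qaction emb h 0 = 0" using qaction_diff_right[of h 0 0] by simp
    then show "0 \<in> ?H" by (metis rangeI)
    fix x y assume "x \<in> ?H" "y \<in> ?H"
    then show "x - y \<in> ?H" by (auto simp flip: qaction_diff_right)
  qed
  have "card (trivial_on ?H) * q ^ (m - degree h) = q ^ degree h * q ^ (m - degree h)"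
    using card_trivial_on[OF H] degree_dvd_X_m_1[OF assms(2)]
    by (simp add: card_range_qaction[OF assms] card_extension flip: power_add)
  then have "card (trivial_on ?H) = q ^ degree h" using q_pos by simp
  then show ?thesis
    using sum_trivial_on[OF H, of "qaction emb f \<alpha>"]
    by (simp add: trivial_on_range_qaction qaction_in_range_iff[OF assms(1,2)])
qed

subsection \<open>The order of a character\<close>

lemma qannihilates_mult: "qannihilates emb h \<chi> \<Longrightarrow> qannihilates emb (h * u) \<chi>"
  by (simp add: qannihilates_def qaction_mult)

lemma qannihilates_diff:
  "additive_character \<chi> \<Longrightarrow> qannihilates emb h \<chi> \<Longrightarrow> qannihilates emb r \<chi> \<Longrightarrow>
    qannihilates emb (h - r) \<chi>"
  by (simp add: qannihilates_def qaction_diff additive_character_diff)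

text \<open>
  The polynomials annihilating \<open>\<chi>\<close> form an ideal, nonzero because it contains $X^m - 1$; division
  with remainder shows that a monic element of least degree generates it and is unique.
\<close>
lemma Fq_Order_generates:
  assumes "additive_character \<chi>"
  shows "monic (Fq_Order emb \<chi>)" and "qannihilates emb h \<chi> \<longleftrightarrow> Fq_Order emb \<chi> dvd h"
proof -
  let ?S = "\<lambda>f. monic f \<and> qannihilates emb f \<chi>"
  let ?min = "\<lambda>f. monic f \<and> qannihilates emb f \<chi> \<and> (\<forall>h. monic h \<and> qannihilates emb h \<chi> \<longrightarrow> degree f \<le> degree h)"
  have "qannihilates emb X_m_1 \<chi>"
    by (simp add: qannihilates_def qaction_X_m_1 additive_character_0[OF assms])
  then have ex: "?S X_m_1" using monic_X_m_1 by blast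
  obtain f where f: "?min f"
    using ex_has_least_nat[of ?S, OF ex, of degree] by blast
  have dvd: "f' dvd h" if f': "?min f'" and h: "qannihilates emb h \<chi>" for f' h
  proof (rule ccontr)
    assume "\<not> f' dvd h"
    let ?r = "h mod f'"
    have nz: "f' \<noteq> 0" using f' by force
    have r: "?r \<noteq> 0" using \<open>\<not> f' dvd h\<close> by (simp add: mod_eq_0_iff_dvd)
    have "qannihilates emb (f' * (h div f')) \<chi>" using f' by (intro qannihilates_mult) simp
    then have "qannihilates emb (h - f' * (h div f')) \<chi>" by (rule qannihilates_diff[OF assms h])
    then have "qannihilates emb ?r \<chi>" by (simp only: minus_mult_div_eq_mod)
    then have "qannihilates emb (?r * [:inverse (lead_coeff ?r):]) \<chi>"
      by (rule qannihilates_mult)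
    then have "?S (smult (inverse (lead_coeff ?r)) ?r)" using r by simp
    then have "degree f' \<le> degree (smult (inverse (lead_coeff ?r)) ?r)" using f' by blast
    then show False using degree_mod_less[OF nz, of h] r by auto
  qed
  have "Fq_Order emb \<chi> = f"
    unfolding Fq_Order_def
  proof (rule the_equality)
    show "?min f" by (rule f)
    fix f' assume f': "?min f'"
    then have "f' dvd f" "f dvd f'" using f by (auto intro: dvd)
    then show "f' = f" using f f' by (intro poly_dvd_antisym) auto
  qed
  moreover have "qannihilates emb h \<chi>" if "f dvd h" for h
    using that f by (auto intro: qannihilates_mult)
  ultimately show "monic (Fq_Order emb \<chi>)" "qannihilates emb h \<chi> \<longleftrightarrow> Fq_Order emb \<chi> dvd h"
    using f dvd[OF f] by blast+
qed

end

section \<open>Characters of a given order\<close>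

text \<open>
  Inclusion and exclusion over the primes of $g$: among the monic divisors of $g$ only $g$ itself divides
  none of the \<open>g / P\<close>, and dividing all \<open>g / P\<close> for \<open>P\<close> in \<open>T\<close> means dividing
  $g / \prod T$, because distinct primes are coprime. The latter quotient is written with the
  exponents of the primes in \<open>T\<close> lowered by one.
\<close>
lemma of_bool_eq_prod_powers:
  fixes A :: "'a::field poly set"
  assumes A: "finite A" "A \<subseteq> {P. irreducible P \<and> monic P}" and "monic d"
  shows "of_bool (d = (\<Prod>P\<in>A. P ^ Suc (a P))) =
    (\<Sum>T\<in>Pow A. (- 1) ^ card T * of_bool (d dvd (\<Prod>P\<in>A. P ^ (if P \<in> T then a P else Suc (a P)))) :: 'c::comm_ring_1)"
proof -
  let ?g = "\<Prod>P\<in>A. P ^ Suc (a P)"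
  define gT where "gT T = (\<Prod>P\<in>A. P ^ (if P \<in> T then a P else Suc (a P)))" for T
  have gT: "?g = gT T * \<Prod>T" if "T \<in> Pow A" for T
  proof -
    have "gT T * \<Prod>T = gT T * (\<Prod>P\<in>A. if P \<in> T then P else 1)"
      using that A(1) by (simp add: prod.If_cases Int_absorb1)
    also have "\<dots> = (\<Prod>P\<in>A. P ^ (if P \<in> T then a P else Suc (a P)) * (if P \<in> T then P else 1))"
      by (simp only: gT_def prod.distrib)
    also have "\<dots> = ?g" by (rule prod.cong) auto
    finally show ?thesis by simp
  qed
  show ?thesis
  proof (cases "d dvd ?g")
    case False
    have "\<not> d dvd gT T" if "T \<in> Pow A" for T
    proof
      assume "d dvd gT T"
      then have "d dvd gT T * \<Prod>T" by (rule dvd_mult2)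
      then show False using False unfolding gT[OF that] by contradiction
    qed
    moreover have "d \<noteq> ?g" using False by auto
    ultimately show ?thesis unfolding gT_def[symmetric] by simp
  next
    case True
    then obtain h where h: "?g = d * h" ..
    have "d \<noteq> 0" using assms(3) by auto
    have monic_h: "monic h"
      using monic_prod_powers[OF A(2), of "\<lambda>P. Suc (a P)"] assms(3)
      unfolding h by (rule monic_right_factor)
    have dvd: "d dvd gT T \<longleftrightarrow> (\<forall>P\<in>T. P dvd h)" if T: "T \<in> Pow A" for T
    proof -
      have T': "finite T" "T \<subseteq> {P. irreducible P \<and> monic P}"
        using T A finite_subset by auto
      have eq: "d * h = gT T * \<Prod>T" unfolding h[symmetric] by (rule gT[OF T])
      have nz: "\<Prod>T \<noteq> 0"
        using monic_prod_powers[OF T'(2), of "\<lambda>_. 1"] by auto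
      have "d dvd gT T \<longleftrightarrow> \<Prod>T dvd h"
      proof
        assume "d dvd gT T"
        then obtain k where "gT T = d * k" ..
        with eq have "d * h = d * (k * \<Prod>T)" by (simp add: mult.assoc)
        then show "\<Prod>T dvd h" using \<open>d \<noteq> 0\<close> by simp
      next
        assume "\<Prod>T dvd h"
        then obtain k where k: "h = \<Prod>T * k" ..
        have "gT T * \<Prod>T = d * (\<Prod>T * k)" by (simp only: k flip: eq)
        also have "\<dots> = (d * k) * \<Prod>T" by (simp only: mult_ac)
        finally have "gT T = d * k" by (rule mult_right_cancel[OF nz, THEN iffD1])
        then show "d dvd gT T" by (rule dvdI)
      qed
      also have "\<dots> \<longleftrightarrow> (\<forall>P\<in>T. P dvd h)"
        using prod_prime_powers_dvd_iff[OF T', of "\<lambda>_. 1" h] by simp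
      finally show ?thesis .
    qed
    have "h dvd ?g" unfolding h by (rule dvd_triv_right)
    have "d = ?g \<longleftrightarrow> h = 1" unfolding h using \<open>d \<noteq> 0\<close> by simp
    also have "\<dots> \<longleftrightarrow> (\<forall>P\<in>A. \<not> P dvd h)"
      by (rule monic_eq_1_iff_no_irreducible_dvd[OF A monic_h \<open>h dvd ?g\<close>])
    finally have "of_bool (d = ?g) = (of_bool (\<forall>P\<in>A. \<not> P dvd h) :: 'c)" by (rule arg_cong)
    also have "\<dots> = (\<Prod>P\<in>A. of_bool (\<not> P dvd h))" by (rule prod_of_bool[OF A(1), symmetric])
    also have "\<dots> = (\<Prod>P\<in>A. 1 - of_bool (P dvd h))" by (rule prod.cong) auto
    also have "\<dots> = (\<Sum>T\<in>Pow A. (- 1) ^ card T * (\<Prod>P\<in>T. of_bool (P dvd h)) * (\<Prod>P\<in>A - T. 1))"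
      by (rule prod_diff_conv_sum[OF A(1)])
    also have "\<dots> = (\<Sum>T\<in>Pow A. (- 1) ^ card T * of_bool (d dvd gT T))"
    proof (rule sum.cong[OF refl])
      fix T assume T: "T \<in> Pow A"
      then have "finite T" using A(1) finite_subset by auto
      then show "(- 1) ^ card T * (\<Prod>P\<in>T. of_bool (P dvd h)) * (\<Prod>P\<in>A - T. 1) =
          ((- 1) ^ card T * of_bool (d dvd gT T) :: 'c)"
        by (simp only: prod_of_bool dvd[OF T] prod.neutral_const mult_1_right)
    qed
    finally show ?thesis unfolding gT_def .
  qed
qed

context finite_field_extension
begin

text \<open>
  This is the analogue of the Ramanujan sum. The inclusion-exclusion formula expresses the
  characters of order \<open>g\<close> through those annihilated by divisors of \<open>g\<close>, and the resulting sum
  over sets of primes is the expansion of an Euler product.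
\<close>
lemma sum_characters_of_order:
  assumes \<alpha>: "normal_element emb m \<alpha>"
    and A: "finite A" "A \<subseteq> {P. irreducible P \<and> monic P}"
    and g: "g = (\<Prod>P\<in>A. P ^ Suc (a P))" "g dvd X_m_1"
  shows "(\<Sum>\<chi> | additive_character \<chi> \<and> Fq_Order emb \<chi> = g. \<chi> (qaction emb f \<alpha>)) =
    of_real (\<Prod>P\<in>A. - (real q ^ (a P * degree P)) * of_bool (P ^ a P dvd f) +
        real q ^ (Suc (a P) * degree P) * of_bool (P ^ Suc (a P) dvd f))"
proof -
  let ?y = "qaction emb f \<alpha>"
  let ?e = "\<lambda>T P. if P \<in> T then a P else Suc (a P)"
  let ?g = "\<lambda>T. \<Prod>P\<in>A. P ^ ?e T P"
  let ?C = "{\<chi> :: 'l \<Rightarrow> complex. additive_character \<chi>}"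
  note fin = finite_additive_characters[where 'l = 'l]
  have "(\<Sum>\<chi> | additive_character \<chi> \<and> Fq_Order emb \<chi> = g. \<chi> ?y) =
      (\<Sum>\<chi>\<in>?C. of_bool (Fq_Order emb \<chi> = g) * \<chi> ?y)"
    by (rule sum.mono_neutral_cong_left) (use fin in auto)
  also have "\<dots> = (\<Sum>\<chi>\<in>?C. \<Sum>T\<in>Pow A. (- 1) ^ card T * (of_bool (qannihilates emb (?g T) \<chi>) * \<chi> ?y))"
  proof (rule sum.cong[OF refl])
    fix \<chi> :: "'l \<Rightarrow> complex" assume "\<chi> \<in> ?C"
    then have \<chi>: "additive_character \<chi>" by simp
    show "of_bool (Fq_Order emb \<chi> = g) * \<chi> ?y =
        (\<Sum>T\<in>Pow A. (- 1) ^ card T * (of_bool (qannihilates emb (?g T) \<chi>) * \<chi> ?y))"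
      unfolding g(1) of_bool_eq_prod_powers[OF A Fq_Order_generates(1)[OF \<chi>]]
        Fq_Order_generates(2)[OF \<chi>]
      by (simp only: sum_distrib_right mult.assoc)
  qed
  also have "\<dots> = (\<Sum>T\<in>Pow A. (- 1) ^ card T * (\<Sum>\<chi>\<in>?C. of_bool (qannihilates emb (?g T) \<chi>) * \<chi> ?y))"
    by (subst sum.swap) (simp only: sum_distrib_left)
  also have "\<dots> = (\<Sum>T\<in>Pow A. (- 1) ^ card T * (of_nat (q ^ degree (?g T)) * of_bool (?g T dvd f)))"
  proof (rule sum.cong[OF refl])
    fix T assume T: "T \<in> Pow A"
    have "?g T dvd g" unfolding g(1) by (rule prod_dvd_prod) (simp add: le_imp_power_dvd)
    then have "?g T dvd X_m_1" using g(2) by (rule dvd_trans)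
    from sum_annihilated_characters[OF \<alpha> this monic_prod_powers[OF A(2)], of f]
    have "(\<Sum>\<chi> | additive_character \<chi> \<and> qannihilates emb (?g T) \<chi>. \<chi> ?y) =
        of_nat (q ^ degree (?g T)) * of_bool (?g T dvd f)" .
    moreover have "(\<Sum>\<chi> | additive_character \<chi> \<and> qannihilates emb (?g T) \<chi>. \<chi> ?y) =
        (\<Sum>\<chi>\<in>?C. of_bool (qannihilates emb (?g T) \<chi>) * \<chi> ?y)"
      by (rule sum.mono_neutral_cong_left) (use fin in auto)
    ultimately show "(- 1) ^ card T * (\<Sum>\<chi>\<in>?C. of_bool (qannihilates emb (?g T) \<chi>) * \<chi> ?y) =
        (- 1) ^ card T * (of_nat (q ^ degree (?g T)) * of_bool (?g T dvd f))"
      by (simp only:)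
  qed
  also have "\<dots> = of_real (\<Sum>T\<in>Pow A. (\<Prod>P\<in>T. - (real q ^ (a P * degree P))) *
      (\<Prod>P\<in>A - T. real q ^ (Suc (a P) * degree P)) * of_bool (?g T dvd f))"
    unfolding of_real_sum
  proof (rule sum.cong[OF refl])
    fix T assume T: "T \<in> Pow A"
    have "(- 1) ^ card T * real (q ^ degree (?g T)) =
        (- 1) ^ card T * (\<Prod>P\<in>A. real q ^ (?e T P * degree P))"
      by (simp only: degree_prod_powers[OF A(2)] of_nat_power of_nat_prod power_sum)
    also have "(\<Prod>P\<in>A. real q ^ (?e T P * degree P)) =
        (\<Prod>P\<in>T. real q ^ (?e T P * degree P)) * (\<Prod>P\<in>A - T. real q ^ (?e T P * degree P))"
      using T A(1) by (subst prod.subset_diff[of T A]) (auto simp only: Pow_iff mult.commute)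
    also have "(\<Prod>P\<in>T. real q ^ (?e T P * degree P)) = (\<Prod>P\<in>T. real q ^ (a P * degree P))"
      by (rule prod.cong) auto
    also have "(\<Prod>P\<in>A - T. real q ^ (?e T P * degree P)) =
        (\<Prod>P\<in>A - T. real q ^ (Suc (a P) * degree P))"
      by (rule prod.cong) auto
    also have "(- 1) ^ card T * ((\<Prod>P\<in>T. real q ^ (a P * degree P)) *
          (\<Prod>P\<in>A - T. real q ^ (Suc (a P) * degree P))) =
        (\<Prod>P\<in>T. - (real q ^ (a P * degree P))) * (\<Prod>P\<in>A - T. real q ^ (Suc (a P) * degree P))"
      by (simp only: prod_uminus mult.assoc)
    finally have eq: "(- 1) ^ card T * real (q ^ degree (?g T)) =
        (\<Prod>P\<in>T. - (real q ^ (a P * degree P))) * (\<Prod>P\<in>A - T. real q ^ (Suc (a P) * degree P))" .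
    have "(- 1) ^ card T * (of_nat (q ^ degree (?g T)) * of_bool (?g T dvd f)) =
        complex_of_real ((- 1) ^ card T * real (q ^ degree (?g T)) * of_bool (?g T dvd f))"
      by (cases "?g T dvd f") simp_all
    then show "(- 1) ^ card T * (of_nat (q ^ degree (?g T)) * of_bool (?g T dvd f)) =
        complex_of_real ((\<Prod>P\<in>T. - (real q ^ (a P * degree P))) *
      (\<Prod>P\<in>A - T. real q ^ (Suc (a P) * degree P)) * of_bool (?g T dvd f))"
      by (simp only: eq)
  qed
  finally show ?thesis by (simp only: prod_two_exponents[OF A])
qed

end

section \<open>The sum over all polynomials\<close>

theorem proposition4p5:
  fixes emb :: "'k::{finite,field} \<Rightarrow> 'l::{finite,field}"
    and q m :: nat
    and g :: "'k poly"
    and \<alpha> :: 'l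
  assumes "CARD('k) = q"
    and "m \<ge> 1"
    and "CARD('l) = q ^ m"
    and "field_hom emb"
    and "monic g"
    and "g dvd monom 1 m - 1"
    and "normal_element emb m \<alpha>"
  shows "(\<Sum>f | degree f < m.
            cmod (\<Sum>\<chi> | additive_character \<chi> \<and> Fq_Order emb \<chi> = g. \<chi> (qaction emb f \<alpha>)))
         = real (q ^ (m - degree g) * poly_phi g * poly_W g)"
proof -
  interpret field_hom emb by (rule assms(4))
  interpret finite_field_extension emb q m
    using assms by unfold_locales simp_all
  obtain A a where A: "finite A" "A \<subseteq> {P. irreducible P \<and> monic P}"
    and g: "g = (\<Prod>P\<in>A. P ^ Suc (a P))"
    using monic_irreducible_factorization[OF assms(5)] by blast
  have deg: "degree g \<le> m" using assms(6) by (rule degree_dvd_X_m_1)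
  have q2: "real q \<ge> 2"
  proof -
    have "card {0, 1 :: 'k} \<le> CARD('k)" by (rule card_mono) simp_all
    then show ?thesis by simp
  qed
  \<comment> \<open>A local factor is $N^{a+1} - N^a$, $-N^a$ or $0$, where $N = q^{\deg P}$, according to how
    often \<open>P\<close> divides \<open>f\<close>; its absolute value is again a combination of the same two indicators.\<close>
  have abs_factor: "\<bar>- (real q ^ (a P * degree P)) * of_bool (P ^ a P dvd f) +
        real q ^ (Suc (a P) * degree P) * of_bool (P ^ Suc (a P) dvd f)\<bar> =
      real q ^ (a P * degree P) * of_bool (P ^ a P dvd f) +
        (real q ^ (Suc (a P) * degree P) - 2 * real q ^ (a P * degree P)) * of_bool (P ^ Suc (a P) dvd f)"
    for P f
  proof (cases "P ^ Suc (a P) dvd f")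
    case True
    then have "P ^ a P dvd f" by (metis dvd_mult_right power_Suc)
    moreover have "real q ^ (a P * degree P) \<le> real q ^ (Suc (a P) * degree P)"
      using q2 by (intro power_increasing) auto
    ultimately show ?thesis using True by simp
  qed simp
  have "(\<Sum>f | degree f < m.
      cmod (\<Sum>\<chi> | additive_character \<chi> \<and> Fq_Order emb \<chi> = g. \<chi> (qaction emb f \<alpha>))) =
    (\<Sum>f\<in>polys_below m. \<Prod>P\<in>A.
      real q ^ (a P * degree P) * of_bool (P ^ a P dvd f) +
      (real q ^ (Suc (a P) * degree P) - 2 * real q ^ (a P * degree P)) * of_bool (P ^ Suc (a P) dvd f))"
    unfolding degree_less_conv_polys_below[OF m_pos] sum_characters_of_order[OF assms(7) A g assms(6)]
      norm_of_real abs_prod abs_factor ..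
  also have "\<dots> = real q ^ m * (\<Prod>P\<in>A.
      real q ^ (a P * degree P) / real q ^ (a P * degree P) +
      (real q ^ (Suc (a P) * degree P) - 2 * real q ^ (a P * degree P)) / real q ^ (Suc (a P) * degree P))"
    using sum_prod_two_exponents[OF A, of a "\<lambda>P. Suc (a P)" m] deg unfolding g by simp
  also have "\<dots> = real q ^ m * (\<Prod>P\<in>A. 2 * (1 - 1 / real q ^ degree P))"
  proof (intro arg_cong[where f = "\<lambda>x. _ * x"] prod.cong refl)
    fix P
    have "real q ^ (Suc (a P) * degree P) = real q ^ (a P * degree P) * real q ^ degree P"
      by (simp add: power_add mult.commute)
    then show "real q ^ (a P * degree P) / real q ^ (a P * degree P) +
      (real q ^ (Suc (a P) * degree P) - 2 * real q ^ (a P * degree P)) / real q ^ (Suc (a P) * degree P) =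
      2 * (1 - 1 / real q ^ degree P)"
      using q2 by (simp add: field_simps)
  qed
  also have "\<dots> = real q ^ (m - degree g) *
      (real q ^ degree g * (\<Prod>P\<in>A. 1 - 1 / real q ^ degree P)) * 2 ^ card A"
  proof -
    have "real q ^ m = real q ^ (m - degree g) * real q ^ degree g"
      using deg by (simp flip: power_add)
    then show ?thesis by (simp only: prod.distrib prod_constant mult_ac)
  qed
  also have "real q ^ degree g * (\<Prod>P\<in>A. 1 - 1 / real q ^ degree P) = real (poly_phi g)"
    using poly_phi_prod_powers[OF A g] by simp
  also have "(2 :: real) ^ card A = real (poly_W g)"
    using card_squarefree_divisors[OF A, of a] by (simp add: poly_W_def g)
  finally show ?thesis by simp
qed

end
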